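(* There exist a dendrite $\mathcal{D}$ and a continuous map $f\colon\mathcal{D}\to\mathcal{D}$ such that: (1) $f$ has a DC1 pair; (2) $f$ does not have an infinite LY-scrambled set.
   Context: A continuum is a nonempty connected compact metric space; a dendrite is a locally connected continuum containing no subset homeomorphic to the circle. Let $X$ be a compact metric space with metric $\rho$ and $f\colon X\to X$ continuous. DC1 pairs: for $x,y\in X$, $n\ge 1$ and $t\in(0,\operatorname{diam}X]$ let $F^{(n)}_{xy}(t)=\frac1n|\{0\le i<n:\rho(f^i(x),f^i(y))<t\}|$, $F_{xy}(t)=\liminf_{n\to\infty}F^{(n)}_{xy}(t)$, $F^*_{xy}(t)=\limsup_{n\to\infty}F^{(n)}_{xy}(t)$, extended by $F_{xy}(t)=F^*_{xy}(t)=0$ for $t\le0$ and $F_{xy}(t)=F^*_{xy}(t)=1$ for $t>\operatorname{diam}X$. The pair $(x,y)$ is a DC1 pair for $f$ if $F^*_{xy}(t)=1$ for all $t>0$ and there is $s>0$ such that $F_{xy}(s)=0$. LY-scrambled set: a set $S\subseteq X$ is LY-scrambled for $f$ if it contains at least two points and for any $x,y\in S$ with $x\neq y$ we have $\liminf_{n\to\infty}\rho(f^n(x),f^n(y))=0$ and $\limsup_{n\to\infty}\rho(f^n(x),f^n(y))>0$. *)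

theory Defs
  imports "HOL-Analysis.Analysis"
begin

definition continuum :: "'a metric \<Rightarrow> bool" where
  "continuum m \<longleftrightarrow>
     mspace m \<noteq> {} \<and> compact_space (mtopology_of m) \<and> connected_space (mtopology_of m)"

definition dendrite :: "'a metric \<Rightarrow> bool" where
  "dendrite m \<longleftrightarrow>
     continuum m \<and> locally_connected_space (mtopology_of m) \<and>
     \<not> (\<exists>C \<subseteq> mspace m.
          subtopology (mtopology_of m) C homeomorphic_space top_of_set (sphere (0::complex) 1))"

(* The supremum is that of a bounded set whenever m is compact. *)
definition mdiam :: "'a metric \<Rightarrow> real" where
  "mdiam m = (SUP p \<in> mspace m \<times> mspace m. mdist m (fst p) (snd p))"

definition dist_freq :: "'a metric \<Rightarrow> ('a \<Rightarrow> 'a) \<Rightarrow> 'a \<Rightarrow> 'a \<Rightarrow> nat \<Rightarrow> real \<Rightarrow> real" where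
  "dist_freq m f x y n t =
     real (card {i. i < n \<and> mdist m ((f ^^ i) x) ((f ^^ i) y) < t}) / real n"

(* Limits inferior and superior are taken in the extended reals, a complete lattice; the value
   of dist_freq at n = 0 does not affect them. *)
definition lower_distribution :: "'a metric \<Rightarrow> ('a \<Rightarrow> 'a) \<Rightarrow> 'a \<Rightarrow> 'a \<Rightarrow> real \<Rightarrow> ereal" where
  "lower_distribution m f x y t =
     (if t \<le> 0 then 0 else if t > mdiam m then 1
      else liminf (\<lambda>n. ereal (dist_freq m f x y n t)))"

definition upper_distribution :: "'a metric \<Rightarrow> ('a \<Rightarrow> 'a) \<Rightarrow> 'a \<Rightarrow> 'a \<Rightarrow> real \<Rightarrow> ereal" where
  "upper_distribution m f x y t =
     (if t \<le> 0 then 0 else if t > mdiam m then 1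
      else limsup (\<lambda>n. ereal (dist_freq m f x y n t)))"

definition DC1_pair :: "'a metric \<Rightarrow> ('a \<Rightarrow> 'a) \<Rightarrow> 'a \<Rightarrow> 'a \<Rightarrow> bool" where
  "DC1_pair m f x y \<longleftrightarrow>
     x \<in> mspace m \<and> y \<in> mspace m \<and>
     (\<forall>t>0. upper_distribution m f x y t = 1) \<and>
     (\<exists>s>0. lower_distribution m f x y s = 0)"

definition LY_scrambled :: "'a metric \<Rightarrow> ('a \<Rightarrow> 'a) \<Rightarrow> 'a set \<Rightarrow> bool" where
  "LY_scrambled m f S \<longleftrightarrow>
     S \<subseteq> mspace m \<and> (\<exists>x\<in>S. \<exists>y\<in>S. x \<noteq> y) \<and>
     (\<forall>x\<in>S. \<forall>y\<in>S. x \<noteq> y \<longrightarrow>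
        liminf (\<lambda>n. ereal (mdist m ((f ^^ n) x) ((f ^^ n) y))) = 0 \<and>
        limsup (\<lambda>n. ereal (mdist m ((f ^^ n) x) ((f ^^ n) y))) > 0)"

end

theory Submission
  imports Defs "HOL-Real_Asymp.Real_Asymp"
begin

text \<open>
  The dendrite is a comb in the plane: the base \<open>[-1, 1]\<close> with vertical teeth of heights \<open>(1/2)^n\<close> over
  distinct points \<open>b n\<close>. The map fixes the base pointwise, sends the upper half of the \<open>n\<close>-th tooth onto
  the next tooth and unfolds the lower half onto the segment from \<open>b n\<close> to \<open>b (Suc n)\<close>. It is continuous
  because \<open>b (Suc n) - b n \<longlonglongrightarrow> 0\<close>. Every point other than a tip of a tooth ends up fixed on the base, and any
  two tips are asymptotic, so a scrambled set has at most one tip and one other point.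
  Since \<open>b n\<close> stays close to \<open>sin (ln (ln n))\<close>, the tips linger near each end of the base for
  times that dwarf everything before, which makes a tip and an end point of the base a DC1 pair.
\<close>

section \<open>Limits along subsequences and frequencies of events\<close>

lemma le_limsup_along:
  fixes X :: "nat \<Rightarrow> real"
  assumes h: "filterlim h sequentially sequentially" and lim: "(\<lambda>k. X (h k)) \<longlonglongrightarrow> L"
  shows "ereal L \<le> limsup (\<lambda>n. ereal (X n))"
proof (rule ccontr)
  assume "\<not> ereal L \<le> limsup (\<lambda>n. ereal (X n))"
  then have "limsup (\<lambda>n. ereal (X n)) < ereal L" by simp
  then obtain z where z: "limsup (\<lambda>n. ereal (X n)) < z" "z < ereal L"
    using dense by blast
  have "eventually (\<lambda>n. ereal (X n) < z) sequentially"
    by (rule Limsup_lessD[OF z(1)])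
  then have "eventually (\<lambda>k. ereal (X (h k)) < z) sequentially"
    using h by (rule eventually_compose_filterlim)
  moreover have "eventually (\<lambda>k. z < ereal (X (h k))) sequentially"
    using lim z(2) by (intro order_tendstoD(1)) simp_all
  ultimately have "eventually (\<lambda>k::nat. False) sequentially"
    by eventually_elim auto
  then show False by simp
qed

lemma liminf_le_along:
  fixes X :: "nat \<Rightarrow> real"
  assumes h: "filterlim h sequentially sequentially" and lim: "(\<lambda>k. X (h k)) \<longlonglongrightarrow> L"
  shows "liminf (\<lambda>n. ereal (X n)) \<le> ereal L"
proof -
  have "ereal (- L) \<le> limsup (\<lambda>n. ereal (- X n))"
    by (rule le_limsup_along[OF h]) (intro tendsto_minus lim)
  moreover have "limsup (\<lambda>n. ereal (- X n)) = - liminf (\<lambda>n. ereal (X n))"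
    using ereal_Limsup_uminus[of sequentially "\<lambda>n. ereal (X n)"] by simp
  ultimately show ?thesis
    by (metis ereal_minus_le_minus uminus_ereal.simps(1))
qed

text \<open>Every index below \<open>N k\<close> at which \<open>P\<close> fails lies below
  \<open>M k\<close>, so up to time \<open>N k\<close> the failures have proportion at most
  \<open>M k / N k\<close>, which tends to 0. The trivial bounds 1 and 0 turn the two subsequential
  limits into the exact limsup and liminf.\<close>

lemma frequency_along_windows:
  fixes P :: "nat \<Rightarrow> bool"
  assumes N: "filterlim N sequentially sequentially"
    and ratio: "(\<lambda>k. real (M k) / real (N k)) \<longlonglongrightarrow> 0"
    and P: "eventually (\<lambda>k. \<forall>i. M k \<le> i \<and> i < N k \<longrightarrow> P i) sequentially"
  shows limsup_frequency_windows:
      "limsup (\<lambda>n. ereal (real (card {i. i < n \<and> P i}) / real n)) = 1"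
    and liminf_frequency_windows:
      "liminf (\<lambda>n. ereal (real (card {i. i < n \<and> \<not> P i}) / real n)) = 0"
proof -
  let ?A = "\<lambda>n. {i. i < n \<and> P i}" and ?B = "\<lambda>n. {i. i < n \<and> \<not> P i}"
  have split: "card (?A n) + card (?B n) = n" for n
  proof -
    have "card (?A n \<union> ?B n) = card (?A n) + card (?B n)"
      by (rule card_Un_disjoint) auto
    moreover have "?A n \<union> ?B n = {..<n}" by auto
    ultimately show ?thesis by simp
  qed
  have B0: "(\<lambda>k. real (card (?B (N k))) / real (N k)) \<longlonglongrightarrow> 0"
  proof (rule tendsto_sandwich[OF _ _ tendsto_const ratio])
    show "\<forall>\<^sub>F k in sequentially. real (card (?B (N k))) / real (N k) \<le> real (M k) / real (N k)"
      using P
    proof eventually_elim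
      case (elim k)
      have "?B (N k) \<subseteq> {..<M k}"
      proof
        fix i assume "i \<in> ?B (N k)"
        with elim show "i \<in> {..<M k}" by (cases "i < M k") auto
      qed
      then have "card (?B (N k)) \<le> card {..<M k}" by (intro card_mono) auto
      then have "real (card (?B (N k))) \<le> real (M k)" by simp
      then show ?case by (simp add: divide_right_mono)
    qed
  qed simp
  have "(\<lambda>k. 1 - real (card (?B (N k))) / real (N k)) \<longlonglongrightarrow> 1 - 0"
    by (intro tendsto_intros B0)
  moreover have "\<forall>\<^sub>F k in sequentially.
      1 - real (card (?B (N k))) / real (N k) = real (card (?A (N k))) / real (N k)"
    using filterlim_at_top[THEN iffD1, OF N, rule_format, of 1]
  proof eventually_elim
    case (elim k)
    have "real (card (?A (N k))) + real (card (?B (N k))) = real (N k)"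
      unfolding of_nat_add[symmetric] split ..
    with elim show ?case by (simp add: field_simps)
  qed
  ultimately have A1: "(\<lambda>k. real (card (?A (N k))) / real (N k)) \<longlonglongrightarrow> 1"
    using tendsto_cong by force
  have "card (?A n) \<le> n" for n using split[of n] by linarith
  \<comment> \<open>At \<open>n = 0\<close> the quotient is 0, since division by zero yields
    0.\<close>
  then have "real (card (?A n)) / real n \<le> 1" for n
    by (metis divide_le_eq_1 div_by_0 gr0I of_nat_0 of_nat_0_less_iff of_nat_mono zero_le_one)
  then have "limsup (\<lambda>n. ereal (real (card (?A n)) / real n)) \<le> 1"
    by (intro Limsup_bounded) (auto simp: one_ereal_def)
  with le_limsup_along[OF N A1]
  show "limsup (\<lambda>n. ereal (real (card (?A n)) / real n)) = 1"
    by (simp add: one_ereal_def)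
  have "0 \<le> liminf (\<lambda>n. ereal (real (card (?B n)) / real n))"
    by (intro Liminf_bounded) auto
  with liminf_le_along[OF N B0]
  show "liminf (\<lambda>n. ereal (real (card (?B n)) / real n)) = 0"
    by (simp add: zero_ereal_def)
qed

section \<open>A slowly oscillating sequence of distinct points\<close>

definition osc :: "nat \<Rightarrow> real" where
  "osc n = sin (ln (ln (real n)))"

lemma abs_sin_diff_le: "\<bar>sin x - sin y\<bar> \<le> \<bar>x - y\<bar>" for x y :: real
proof -
  have "\<bar>sin x - sin y\<bar> = 2 * \<bar>sin ((x - y) / 2)\<bar> * \<bar>cos ((x + y) / 2)\<bar>"
    by (simp add: sin_diff_sin abs_mult)
  also have "\<dots> \<le> 2 * \<bar>(x - y) / 2\<bar> * 1"
    by (intro mult_mono abs_sin_x_le_abs_x) auto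
  finally show ?thesis by simp
qed

text \<open>Sine is 1-Lipschitz and the increments of the iterated logarithm vanish in the limit.
  The continuity of the map on the comb rests on this.\<close>

lemma osc_increment: "(\<lambda>n. osc (Suc n) - osc n) \<longlonglongrightarrow> 0"
proof (rule Lim_null_comparison)
  show "\<forall>\<^sub>F n in sequentially.
      norm (osc (Suc n) - osc n) \<le> \<bar>ln (ln (real (Suc n))) - ln (ln (real n))\<bar>"
    unfolding osc_def real_norm_def by (intro always_eventually allI abs_sin_diff_le)
  show "(\<lambda>n. \<bar>ln (ln (real (Suc n))) - ln (ln (real n))\<bar>) \<longlonglongrightarrow> 0"
    by real_asymp
qed

text \<open>
  Rescaling the logarithm by a factor \<open>q < 1\<close> gives windows \<open>M k \<le> i < N k\<close> with
  \<open>M k / N k \<longlonglongrightarrow> 0\<close>, while the iterated logarithm varies over them by \<open>ln (1 / q)\<close> only.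
\<close>
lemma osc_windows:
  fixes \<theta> \<delta> :: real
  assumes "\<delta> > 0"
  obtains M N :: "nat \<Rightarrow> nat" where
    "filterlim M sequentially sequentially"
    "filterlim N sequentially sequentially"
    "(\<lambda>k. real (M k) / real (N k)) \<longlonglongrightarrow> 0"
    "\<And>k i. M k \<le> i \<Longrightarrow> i < N k \<Longrightarrow> \<bar>osc i - sin \<theta>\<bar> \<le> \<delta>"
proof -
  \<comment> \<open>This choice makes \<open>ln (q * exp c) = c - \<delta>\<close>, so a window
    spans the length \<open>\<delta>\<close> on the scale of the iterated logarithm.\<close>
  define q where "q = exp (- \<delta>)"
  have q: "0 < q" "q < 1" using assms by (auto simp: q_def)
  \<comment> \<open>These points tend to infinity while sine takes the value
    \<open>sin \<theta>\<close> at each of them.\<close>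
  define c where "c k = \<theta> + 2 * pi * real k" for k :: nat
  define N where "N k = nat \<lfloor>exp (exp (c k))\<rfloor>" for k
  \<comment> \<open>The summand 3 forces \<open>3 \<le> i\<close> in the window, so that
    \<open>ln (real i)\<close> is positive and its logarithm can be compared.\<close>
  define M where "M k = nat \<lceil>exp (q * exp (c k))\<rceil> + 3" for k
  have "filterlim (\<lambda>k. 2 * pi * real k) at_top sequentially"
    by (intro filterlim_tendsto_pos_mult_at_top[OF tendsto_const] filterlim_real_sequentially) simp
  then have "filterlim c at_top sequentially"
    unfolding c_def by (intro filterlim_tendsto_add_at_top[OF tendsto_const])
  then have e: "filterlim (\<lambda>k. exp (c k)) at_top sequentially"
    by (rule filterlim_compose[OF exp_at_top])
  have "filterlim (\<lambda>y. nat \<lfloor>exp y\<rfloor>) sequentially (at_top :: real filter)"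
    by (intro filterlim_compose[OF filterlim_nat_sequentially]
        filterlim_compose[OF filterlim_floor_sequentially] exp_at_top)
  then have N: "filterlim N sequentially sequentially"
    unfolding N_def by (rule filterlim_compose[OF _ e])
  have "filterlim (\<lambda>y. nat \<lceil>exp (q * y)\<rceil> + 3) sequentially (at_top :: real filter)"
    using q by real_asymp
  then have M: "filterlim M sequentially sequentially"
    unfolding M_def by (rule filterlim_compose[OF _ e])
  have "((\<lambda>y::real. (exp (q * y) + 4) / (exp y - 1)) \<longlongrightarrow> 0) at_top"
    using q by real_asymp
  then have lim: "(\<lambda>k. (exp (q * exp (c k)) + 4) / (exp (exp (c k)) - 1)) \<longlonglongrightarrow> 0"
    by (rule filterlim_compose[OF _ e])
  have ratio: "(\<lambda>k. real (M k) / real (N k)) \<longlonglongrightarrow> 0"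
  proof (rule tendsto_sandwich[OF _ _ tendsto_const lim])
    show "\<forall>\<^sub>F k in sequentially.
        real (M k) / real (N k) \<le> (exp (q * exp (c k)) + 4) / (exp (exp (c k)) - 1)"
    proof (rule always_eventually, rule allI, rule frac_le)
      fix k
      show "real (M k) \<le> exp (q * exp (c k)) + 4" "exp (exp (c k)) - 1 \<le> real (N k)"
        unfolding M_def N_def
        by (simp_all add: le_floor_iff) linarith+
      show "0 < exp (exp (c k)) - 1" by simp
    qed simp
  qed simp
  have "\<bar>osc i - sin \<theta>\<bar> \<le> \<delta>" if "M k \<le> i" "i < N k" for k i
  proof -
    have i: "exp (exp (c k - \<delta>)) \<le> real i" "3 \<le> i"
      using that(1) unfolding M_def q_def
      by (auto simp: exp_diff exp_minus field_simps) linarith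
    have "int i < \<lfloor>exp (exp (c k))\<rfloor>" using that(2) by (simp add: N_def)
    then have i': "real i \<le> exp (exp (c k))" by linarith
    have "exp (c k - \<delta>) \<le> ln (real i)" 
      using i by (subst ln_ge_iff) auto
    moreover have pos: "0 < ln (real i)" using i(2) by simp
    ultimately have 1: "c k - \<delta> \<le> ln (ln (real i))"
      by (subst ln_ge_iff) auto
    have "ln (real i) \<le> exp (c k)"
      using i' i(2) by (metis exp_gt_zero ln_exp ln_le_cancel_iff of_nat_0_less_iff less_le_trans zero_less_numeral)
    then have 2: "ln (ln (real i)) \<le> c k"
      using pos by (metis exp_gt_zero ln_exp ln_le_cancel_iff)
    have "sin (c k) = sin \<theta>"
      unfolding c_def using sin.plus_of_nat[of \<theta> k] by (simp add: mult_ac)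
    then have "\<bar>osc i - sin \<theta>\<bar> \<le> \<bar>ln (ln (real i)) - c k\<bar>"
      using abs_sin_diff_le[of "ln (ln (real i))" "c k"] by (simp add: osc_def)
    with 1 2 show ?thesis by linarith
  qed
  with M N ratio show ?thesis by (rule that)
qed

text \<open>Distinct teeth need distinct feet, so \<open>osc n\<close> is perturbed by at most
  \<open>1 / (n + 1)\<close>. The allowed values form a nondegenerate interval inside
  \<open>[-1, 1]\<close>, and only finitely many points of it are already taken.\<close>

lemma injective_osc:
  obtains b :: "nat \<Rightarrow> real" where
    "inj b" "\<And>n. b n \<in> {-1..1}" "(\<lambda>n. b n - osc n) \<longlonglongrightarrow> 0"
proof -
  define I where "I n = {max (-1) (osc n - inverse (Suc n))..min 1 (osc n + inverse (Suc n))}" for n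
  have "\<exists>b. \<forall>n. b n \<in> I n - b ` {..<n}"
  \<comment> \<open>The first goal says that the choice at \<open>n\<close> depends on the earlier
    values only; the second that a choice exists.\<close>
  proof (rule dependent_wellorder_choice)
    fix r :: real and f g :: "nat \<Rightarrow> real" and n
    assume "\<And>m. m < n \<Longrightarrow> f m = g m"
    then have "f ` {..<n} = g ` {..<n}" by (intro image_cong) auto
    then show "(r \<in> I n - f ` {..<n}) = (r \<in> I n - g ` {..<n})" by simp
  next
    fix n :: nat and f :: "nat \<Rightarrow> real"
    have "-1 \<le> osc n" "osc n \<le> 1" by (simp_all add: osc_def)
    moreover have "0 < inverse (real (Suc n))" by simp
    ultimately have "max (-1) (osc n - inverse (Suc n)) < min 1 (osc n + inverse (Suc n))"
      by linarith
    then have "infinite (I n)" unfolding I_def by (rule infinite_Icc)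
    then have "infinite (I n - f ` {..<n})" by simp
    then have "I n - f ` {..<n} \<noteq> {}" by (metis finite.emptyI)
    then show "\<exists>r. r \<in> I n - f ` {..<n}" by blast
  qed
  then obtain b where b: "\<And>n. b n \<in> I n - b ` {..<n}" by blast
  have "b m \<noteq> b n" if "m < n" for m n
    using b[of n] that by (metis DiffD2 imageI lessThan_iff)
  then have "inj b" by (intro linorder_injI) auto
  moreover have "b n \<in> {-1..1}" for n using b[of n] by (auto simp: I_def)
  moreover have "(\<lambda>n. b n - osc n) \<longlonglongrightarrow> 0"
  proof (rule Lim_null_comparison[OF _ LIMSEQ_inverse_real_of_nat])
    show "\<forall>\<^sub>F n in sequentially. norm (b n - osc n) \<le> inverse (real (Suc n))"
    proof (rule always_eventually, rule allI)
      show "norm (b n - osc n) \<le> inverse (real (Suc n))" for n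
        using b[of n] unfolding I_def by (auto simp: abs_le_iff)
    qed
  qed
  ultimately show ?thesis by (rule that)
qed

section \<open>Excluding circles and copying a planar set to another type\<close>

text \<open>On a circle, the points 1 and -1 are joined by two arcs that meet only at these ends. A
  point separating their images would have to lie on the images of both arcs, which injectivity
  forbids.\<close>

lemma no_circle_if_separated:
  assumes sep: "\<And>p q. p \<in> topspace X \<Longrightarrow> q \<in> topspace X \<Longrightarrow> p \<noteq> q \<Longrightarrow>
      \<exists>z. z \<noteq> p \<and> z \<noteq> q \<and> (\<forall>S. connectedin X S \<and> p \<in> S \<and> q \<in> S \<longrightarrow> z \<in> S)"
  shows "\<not> subtopology X C homeomorphic_space top_of_set (sphere (0::complex) 1)"
proof
  assume "subtopology X C homeomorphic_space top_of_set (sphere (0::complex) 1)"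
  then obtain g where "homeomorphic_map (top_of_set (sphere (0::complex) 1)) (subtopology X C) g"
    using homeomorphic_space_sym homeomorphic_space by blast
  then have "continuous_map (top_of_set (sphere (0::complex) 1)) (subtopology X C) g"
    and inj: "inj_on g (sphere 0 1)"
    by (auto simp: homeomorphic_imp_continuous_map dest: homeomorphic_imp_injective_map)
  then have g: "continuous_map (top_of_set (sphere (0::complex) 1)) X g"
    by (simp add: continuous_map_in_subtopology)
  have top: "g u \<in> topspace X" if "u \<in> sphere 0 1" for u
    using continuous_map_image_subset_topspace[OF g] that by auto
  define H where "H a b = cis ` {a..b}" for a b :: real
  have H: "connectedin X (g ` H a b)" for a b
  proof (rule connectedin_continuous_map_image[OF g])
    have "connected (H a b)" unfolding H_def
      by (intro connected_continuous_image continuous_intros connected_Icc)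
    then show "connectedin (top_of_set (sphere 0 1)) (H a b)"
      by (auto simp: connectedin_subtopology H_def)
  qed
  have "g 1 \<noteq> g (-1)" using inj_onD[OF inj, of 1 "-1"] by auto
  then obtain z where z: "z \<noteq> g 1" "z \<noteq> g (-1)"
      "\<And>S. connectedin X S \<Longrightarrow> g 1 \<in> S \<Longrightarrow> g (-1) \<in> S \<Longrightarrow> z \<in> S"
    using sep[of "g 1" "g (-1)"] top by auto
  have "1 \<in> H 0 pi" "-1 \<in> H 0 pi"
    unfolding H_def using image_eqI[of _ cis 0] image_eqI[of _ cis pi] by auto
  then have "z \<in> g ` H 0 pi" by (intro z(3) H imageI)
  then obtain s where s: "0 \<le> s" "s \<le> pi" "z = g (cis s)" by (auto simp: H_def)
  have "1 \<in> H pi (2 * pi)" "-1 \<in> H pi (2 * pi)"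
    unfolding H_def using image_eqI[of _ cis "2 * pi"] image_eqI[of _ cis pi] by auto
  then have "z \<in> g ` H pi (2 * pi)" by (intro z(3) H imageI)
  then obtain t where t: "pi \<le> t" "t \<le> 2 * pi" "z = g (cis t)" by (auto simp: H_def)
  have "cis s = cis t" using s(3) t(3) inj by (auto simp: inj_on_def)
  then have *: "cos s = cos t" "sin s = sin t" by (simp_all add: cis.code)
  \<comment> \<open>Sine is nonnegative on the upper arc and nonpositive on the lower one, so a
    common point is 1 or -1.\<close>
  have "0 \<le> sin s" using s by (simp add: sin_ge_zero)
  moreover have "sin t \<le> 0" using t by (cases "t = 2 * pi") (auto simp: sin_le_zero)
  ultimately have "sin s = 0" using * by linarith
  then have "cos s = 1 \<or> cos s = -1" using sin_zero_abs_cos_one by fastforce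
  with \<open>sin s = 0\<close> have "cis s = 1 \<or> cis s = -1" by (auto simp: complex_eq_iff)
  with z s(3) show False by auto
qed

text \<open>The theorem asks for a space of functions, whereas the comb lies in the plane. With the
  metric pulled back along \<open>inv e\<close>, both \<open>e\<close> and its inverse are
  1-Lipschitz.\<close>

lemma isometric_copy:
  fixes e :: "'a::metric_space \<Rightarrow> 'b"
  assumes "inj e"
  obtains m :: "'b metric" where
    "mspace m = e ` K" "\<And>x y. mdist m (e x) (e y) = dist x y"
    "homeomorphic_maps (top_of_set K) (mtopology_of m) e (inv e)"
proof -
  let ?d = "\<lambda>x y. dist (inv e x) (inv e y)"
  have inv: "inv e (e x) = x" for x using assms by simp
  interpret Metric_space "e ` K" ?d
    by unfold_locales (auto simp: inv dist_commute dist_triangle)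
  define m where "m = metric (e ` K, ?d)"
  have sp: "mspace m = e ` K" and di: "mdist m = ?d" by (simp_all add: m_def)
  have top: "top_of_set K = mtopology_of (submetric euclidean_metric K)"
    by (simp add: mtopology_of_submetric)
  have "continuous_map (top_of_set K) (mtopology_of m) e"
    unfolding top
    by (intro Lipschitz_continuous_imp_continuous_map)
      (auto simp: Lipschitz_continuous_map_def sp di inv intro: exI[of _ 1])
  moreover have "continuous_map (mtopology_of m) (top_of_set K) (inv e)"
    unfolding top
    by (intro Lipschitz_continuous_imp_continuous_map)
      (auto simp: Lipschitz_continuous_map_def sp di inv intro: exI[of _ 1])
  ultimately have "homeomorphic_maps (top_of_set K) (mtopology_of m) e (inv e)"
    by (auto simp: homeomorphic_maps_def inv sp)
  with sp show ?thesis by (intro that) (auto simp: di inv)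
qed

section \<open>The comb and its topology\<close>

locale comb_teeth =
  fixes b :: "nat \<Rightarrow> real"
  assumes inj_b: "inj b" and b_range: "\<And>n. b n \<in> {-1..1}"
begin

lemma b_eq_iff [simp]: "b m = b n \<longleftrightarrow> m = n"
  using inj_b by (auto simp: inj_def)

lemma b_bounds [simp]: "-1 \<le> b n" "b n \<le> 1"
  using b_range[of n] by auto

definition tooth :: "nat \<Rightarrow> (real \<times> real) set" where
  "tooth n = {b n} \<times> {0..(1/2)^n}"

text \<open>The index set is a parameter so that \<open>comb (-{n})\<close>, the comb without its
  \<open>n\<close>-th tooth, is covered by the same compactness result.\<close>

definition comb :: "nat set \<Rightarrow> (real \<times> real) set" where
  "comb M = {-1..1} \<times> {0} \<union> (\<Union>n\<in>M. tooth n)"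

lemma mem_comb:
  "(x, y) \<in> comb M \<longleftrightarrow>
     -1 \<le> x \<and> x \<le> 1 \<and> 0 \<le> y \<and> (y = 0 \<or> (\<exists>n\<in>M. x = b n \<and> y \<le> (1/2)^n))"
  by (auto simp: comb_def tooth_def)

lemma comb_UNIV_split: "comb UNIV = tooth n \<union> comb (-{n})"
  by (auto simp: comb_def)

lemma compact_tooth: "compact (tooth n)"
  by (simp add: tooth_def compact_Times)

text \<open>
  Cutting off all teeth from the \<open>N\<close>-th on at height \<open>(1/2)^N\<close> and filling the strip below gives
  a compact set; the comb is the intersection of these sets.
\<close>
lemma compact_comb: "compact (comb M)"
proof -
  define Q where "Q N = {-1..1} \<times> {0..(1/2)^N} \<union> (\<Union>n\<in>M \<inter> {..<N}. tooth n)" for N :: nat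
  have Q: "compact (Q N)" for N
    unfolding Q_def by (intro compact_Un compact_UN compact_tooth compact_Times) auto
  have "comb M = (\<Inter>N. Q N)"
  proof
    show "comb M \<subseteq> (\<Inter>N. Q N)"
    proof clarify
      fix x y N assume p: "(x, y) \<in> comb M"
      show "(x, y) \<in> Q N"
      proof (cases "y = 0 \<or> y \<le> (1/2)^N")
        case False
        with p obtain n where n: "n \<in> M" "x = b n" "0 \<le> y" "y \<le> (1/2)^n"
          by (auto simp: mem_comb)
        have "n < N"
        proof (rule ccontr)
          assume "\<not> n < N"
          then have "(1/2)^n \<le> (1/2::real)^N" by (intro power_decreasing) auto
          with n False show False by linarith
        qed
        with n show ?thesis by (auto simp: Q_def tooth_def)
      qed (use p in \<open>auto simp: Q_def mem_comb\<close>)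
    qed
    show "(\<Inter>N. Q N) \<subseteq> comb M"
    proof clarify
      fix x y assume p: "(x, y) \<in> (\<Inter>N. Q N)"
      then have "(x, y) \<in> Q 0" by blast
      then have xy: "-1 \<le> x" "x \<le> 1" "0 \<le> y" by (auto simp: Q_def)
      show "(x, y) \<in> comb M"
      proof (cases "y = 0")
        case False
        \<comment> \<open>A positive height exceeds \<open>(1/2)^N\<close> for some
          \<open>N\<close>, so membership in \<open>Q N\<close> must come from one of the finitely
          many full teeth.\<close>
        then obtain N where "(1/2)^N < y" using xy real_arch_pow_inv[of y "1/2"] by auto
        moreover have "(x, y) \<in> Q N" using p by blast
        ultimately show ?thesis by (auto simp: Q_def comb_def)
      qed (use xy in \<open>simp add: mem_comb\<close>)
    qed
  qed
  moreover have "closed (\<Inter>N. Q N)" using Q by (intro closed_INT ballI compact_imp_closed)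
  moreover have "(\<Inter>N. Q N) = Q 0 \<inter> (\<Inter>N. Q N)" by blast
  ultimately show ?thesis
    using compact_Int_closed[OF Q[of 0]] by (metis (no_types))
qed

text \<open>Each tooth together with the base is connected, and all these sets share the origin.
  Without teeth the union would be empty, hence the separate case.\<close>

lemma connected_comb: "connected (comb M)"
proof -
  have "connected (tooth n \<union> {-1..1} \<times> {0})" for n
  proof (rule connected_Un)
    have "(b n, 0) \<in> tooth n \<inter> {-1..1} \<times> {0}" using b_range[of n] by (auto simp: tooth_def)
    then show "tooth n \<inter> {-1..1} \<times> {0} \<noteq> {}" by blast
  qed (auto simp: tooth_def intro: connected_Times)
  then have "connected (\<Union>n\<in>M. tooth n \<union> {-1..1} \<times> {0})"
    by (intro connected_Union) (auto intro: exI[of _ 0])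
  moreover have "connected ({-1..1::real} \<times> {0::real})"
    by (intro connected_Times) auto
  moreover have "comb M = (\<Union>n\<in>M. tooth n \<union> {-1..1} \<times> {0})" if "M \<noteq> {}"
    using that by (auto simp: comb_def)
  ultimately show ?thesis by (cases "M = {}") (auto simp: comb_def)
qed

text \<open>It suffices to join nearby points to \<open>p\<close> by connected sets inside
  \<open>V\<close>. At a base point an L-shaped path works; above the base, a vertical segment does,
  as points near \<open>p\<close> lie on the same tooth.\<close>

lemma locally_connected_comb: "locally_connected_space (top_of_set (comb UNIV))"
  unfolding locally_connected_space_im_kleinen
proof (intro allI impI, elim conjE)
  let ?D = "comb UNIV"
  fix V and p :: "real \<times> real"
  assume V: "openin (top_of_set ?D) V" and "p \<in> V"
  from V have VD: "V \<subseteq> ?D" using openin_imp_subset by blast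
  with \<open>p \<in> V\<close> have pD: "p \<in> ?D" by blast
  obtain x y where p: "p = (x, y)" by fastforce
  from V \<open>p \<in> V\<close> obtain e where e: "e > 0" "?D \<inter> ball p e \<subseteq> V"
    unfolding openin_contains_ball by (metis inf_commute)
  have V_if: "(x', y') \<in> V" if "(x', y') \<in> ?D" "\<bar>x' - x\<bar> + \<bar>y' - y\<bar> < e" for x' y'
  proof -
    have "dist p (x', y') \<le> \<bar>x' - x\<bar> + \<bar>y' - y\<bar>"
      unfolding p dist_Pair_Pair dist_real_def
      using sqrt_sum_squares_le_sum_abs[of "x' - x" "y' - y"]
      by (simp add: power2_commute)
    with that e(2) show ?thesis by auto
  qed
  have close: "\<bar>x' - x\<bar> < r" "\<bar>y' - y\<bar> < r" if "(x', y') \<in> ball p r" for x' y' r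
    using that dist_fst_le[of p "(x', y')"] dist_snd_le[of p "(x', y')"]
    by (auto simp: p dist_real_def)
  have conn: "connectedin (top_of_set ?D) C" if "connected C" "C \<subseteq> V" for C
    using that VD by (simp add: connectedin_subtopology subset_trans)
  show "\<exists>U. openin (top_of_set ?D) U \<and> p \<in> U \<and> U \<subseteq> V \<and>
      (\<forall>q\<in>U. \<exists>C. connectedin (top_of_set ?D) C \<and> C \<subseteq> V \<and> p \<in> C \<and> q \<in> C)"
  proof (cases "y = 0")
    case True
    \<comment> \<open>Half the radius, since \<open>V_if\<close> bounds the sum of the two
      coordinate differences.\<close>
    let ?U = "?D \<inter> ball p (e / 2)"
    have "\<exists>C. connectedin (top_of_set ?D) C \<and> C \<subseteq> V \<and> p \<in> C \<and> q \<in> C" if "q \<in> ?U" for q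
    proof -
      obtain u v where q: "q = (u, v)" by fastforce
      have q': "\<bar>u - x\<bar> < e / 2" "\<bar>v\<bar> < e / 2" using that close[of u v "e / 2"] True unfolding q by simp_all
      \<comment> \<open>Down from \<open>q\<close> to the base, then along the base to
        \<open>p\<close>.\<close>
      let ?C = "{u} \<times> {0..v} \<union> closed_segment u x \<times> {0}"
      have uv: "(u, v) \<in> ?D" using that q by simp
      have "connected ?C"
      proof (rule connected_Un)
        have "(u, 0) \<in> ({u} \<times> {0..v}) \<inter> (closed_segment u x \<times> {0})"
          using uv by (simp add: mem_comb)
        then show "({u} \<times> {0..v}) \<inter> (closed_segment u x \<times> {0}) \<noteq> {}" by blast
      qed (simp_all add: connected_Times)
      moreover have "?C \<subseteq> V"
      proof clarify
        fix s t assume "(s, t) \<in> ?C"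
        then consider "s = u" "0 \<le> t" "t \<le> v" | "s \<in> closed_segment u x" "t = 0" by auto
        then show "(s, t) \<in> V"
        proof cases
          case 1
          then have "(s, t) \<in> ?D" using uv by (auto simp: mem_comb)
          moreover have "\<bar>s - x\<bar> + \<bar>t - y\<bar> < e" using 1 q' True by linarith
          ultimately show ?thesis by (rule V_if)
        next
          case 2
          then have "min u x \<le> s" "s \<le> max u x"
            by (auto simp: closed_segment_eq_real_ivl split: if_splits)
          moreover have "-1 \<le> u" "u \<le> 1" "-1 \<le> x" "x \<le> 1"
            using uv pD by (auto simp: mem_comb p)
          ultimately have "-1 \<le> s" "s \<le> 1" by linarith+
          then have "(s, t) \<in> ?D" using 2 by (simp add: mem_comb)
          moreover have "\<bar>s - x\<bar> \<le> \<bar>u - x\<bar>"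
            using \<open>min u x \<le> s\<close> \<open>s \<le> max u x\<close> by linarith
          ultimately have "\<bar>s - x\<bar> + \<bar>t - y\<bar> < e" using 2(2) q' True by linarith
          with \<open>(s, t) \<in> ?D\<close> show ?thesis by (rule V_if)
        qed
      qed
      moreover have "p \<in> ?C" "q \<in> ?C" using uv True by (auto simp: p q mem_comb)
      ultimately show ?thesis using conn by blast
    qed
    moreover have "?U \<subseteq> V" using e by auto
    moreover have "p \<in> ?U" using e pD by simp
    ultimately show ?thesis by (intro exI[of _ ?U]) (auto simp: openin_open_Int)
  next
    case False
    then obtain n where n: "x = b n" "0 < y" "y \<le> (1/2)^n"
      using pD by (auto simp: p mem_comb)
    \<comment> \<open>Removing the rest of the comb, which is compact and misses \<open>p\<close>,
      leaves only points of the \<open>n\<close>-th tooth.\<close>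
    let ?U = "?D \<inter> (ball p e - comb (-{n}))"
    have "open (ball p e - comb (-{n}))"
      using compact_comb by (intro open_Diff compact_imp_closed) auto
    moreover have "p \<in> ?U" using n e pD by (auto simp: p mem_comb)
    moreover have "?U \<subseteq> V" using e by auto
    moreover have "\<exists>C. connectedin (top_of_set ?D) C \<and> C \<subseteq> V \<and> p \<in> C \<and> q \<in> C" if "q \<in> ?U" for q
    proof -
      obtain u v where q: "q = (u, v)" by fastforce
      have uv: "u = b n" "0 \<le> v" "v \<le> (1/2)^n"
        using that comb_UNIV_split[of n] by (auto simp: q tooth_def)
      have q': "\<bar>v - y\<bar> < e" using that close[of u v e] by (auto simp: q)
      let ?C = "{b n} \<times> closed_segment v y"
      have "connected ?C" by (simp add: connected_Times)
      moreover have "?C \<subseteq> V"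
      proof clarify
        fix t assume "t \<in> closed_segment v y"
        then have t: "min v y \<le> t" "t \<le> max v y"
          by (auto simp: closed_segment_eq_real_ivl split: if_splits)
        have "(b n, t) \<in> ?D" using t uv n b_range[of n] by (auto simp: mem_comb)
        then show "(b n, t) \<in> V" using t q' n by (intro V_if) auto
      qed
      moreover have "p \<in> ?C" "q \<in> ?C" using uv n by (auto simp: p q)
      ultimately show ?thesis using conn by blast
    qed
    ultimately show ?thesis by (intro exI[of _ ?U]) (auto simp: openin_open_Int)
  qed
qed

definition height :: "nat \<Rightarrow> real \<times> real \<Rightarrow> real" where
  "height n p = (if fst p = b n then snd p else 0)"

text \<open>The tooth and the rest of the comb are closed. On the rest the function vanishes: the
  other teeth have other abscissae and the base has height 0.\<close>

lemma continuous_on_height: "continuous_on (comb UNIV) (height n)"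
  unfolding comb_UNIV_split[of n]
proof (rule continuous_on_closed_Un)
  show "continuous_on (tooth n) (height n)"
    by (rule continuous_on_eq[of _ snd]) (auto simp: height_def tooth_def intro: continuous_intros)
  show "continuous_on (comb (-{n})) (height n)"
    by (rule continuous_on_eq[of _ "\<lambda>_. 0"]) (auto simp: height_def mem_comb)
qed (auto intro: compact_imp_closed compact_tooth compact_comb)

text \<open>Both cases use the intermediate value theorem on connected sets. For different
  abscissae, a value \<open>c\<close> of \<open>fst\<close> strictly between them and outside the
  countable set \<open>range b\<close> is taken only at \<open>(c, 0)\<close>. On a common tooth,
  the midpoint is the only point where \<open>height n\<close> has its value.\<close>

lemma comb_separated:
  assumes "p \<in> comb UNIV" "q \<in> comb UNIV" "p \<noteq> q"
  shows "\<exists>z. z \<noteq> p \<and> z \<noteq> q \<and>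
    (\<forall>S. connected S \<and> S \<subseteq> comb UNIV \<and> p \<in> S \<and> q \<in> S \<longrightarrow> z \<in> S)"
proof -
  have mid: "\<exists>s\<in>S. g s = t"
    if "connected S" "continuous_on S g" "p \<in> S" "q \<in> S"
      "min (g p) (g q) \<le> t" "t \<le> max (g p) (g q)" for g :: "real \<times> real \<Rightarrow> real" and S t
  proof -
    have "connected (g ` S)" using that by (intro connected_continuous_image)
    then have "is_interval (g ` S)" by (simp add: is_interval_connected_1)
    moreover have "g p \<in> g ` S" "g q \<in> g ` S" using that by auto
    ultimately have "t \<in> g ` S"
      using that(5,6) mem_is_interval_1_I[of "g ` S" "g p" "g q" t] mem_is_interval_1_I[of "g ` S" "g q" "g p" t]
      by (simp only: min_le_iff_disj le_max_iff_disj) (metis linorder_linear order_trans)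
    then show ?thesis by blast
  qed
  show ?thesis
  proof (cases "fst p = fst q")
    case False
    then have "min (fst p) (fst q) < max (fst p) (fst q)" by linarith
    then have "uncountable {min (fst p) (fst q)<..<max (fst p) (fst q)}"
      by (simp add: uncountable_open_interval)
    then have "\<not> {min (fst p) (fst q)<..<max (fst p) (fst q)} \<subseteq> range b"
      using countable_subset countable_image[of UNIV b] by blast
    then obtain c where c: "min (fst p) (fst q) < c" "c < max (fst p) (fst q)" "c \<notin> range b"
      unfolding subset_iff greaterThanLessThan_iff by blast
    have "(c, 0) \<in> S" if S: "connected S" "S \<subseteq> comb UNIV" "p \<in> S" "q \<in> S" for S
    proof -
      obtain s where "s \<in> S" "fst s = c"
        using mid[OF S(1) continuous_on_fst[OF continuous_on_id] S(3,4), of c] c by auto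
      then show ?thesis using S(2) c(3) by (cases s) (auto simp: mem_comb dest!: subsetD)
    qed
    then show ?thesis using c by (intro exI[of _ "(c, 0)"]) auto
  next
    case True
    then have ne: "snd p \<noteq> snd q" using assms by (simp add: prod_eq_iff)
    then obtain n where n: "fst p = b n"
      using assms True by (cases p; cases q) (auto simp: mem_comb)
    have nonneg: "0 \<le> snd p" "0 \<le> snd q" using assms by (cases p; cases q; auto simp: mem_comb)+
    let ?t = "(snd p + snd q) / 2"
    have "(b n, ?t) \<in> S" if S: "connected S" "S \<subseteq> comb UNIV" "p \<in> S" "q \<in> S" for S
    proof -
      have "continuous_on S (height n)" using continuous_on_height S(2) continuous_on_subset by blast
      moreover have "height n p = snd p" "height n q = snd q" using n True by (auto simp: height_def)
      moreover have "min (snd p) (snd q) \<le> ?t" "?t \<le> max (snd p) (snd q)"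
        by (simp_all add: min_def max_def)
      ultimately obtain s where s: "s \<in> S" "height n s = ?t"
        using mid[of S "height n" ?t] S by metis
      \<comment> \<open>Positivity matters because \<open>height n\<close> is 0 off the
        tooth.\<close>
      moreover have "?t > 0" using ne nonneg by (cases "snd p = 0") auto
      ultimately have "s = (b n, ?t)" by (cases s) (auto simp: height_def split: if_splits)
      then show ?thesis using s(1) by simp
    qed
    then show ?thesis using ne n True by (intro exI[of _ "(b n, ?t)"]) (auto simp: prod_eq_iff)
  qed
qed

section \<open>The map on the comb and its orbits\<close>

text \<open>The threshold \<open>(1/2)^Suc n\<close> is half the height of the tooth. Below it
  \<open>max\<close> keeps the image on the base, above it \<open>min\<close> keeps the image over
  \<open>b (Suc n)\<close>, so one continuous formula serves both halves.\<close>

definition glide :: "nat \<Rightarrow> real \<times> real \<Rightarrow> real \<times> real" where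
  "glide n p = (b n + min 1 (snd p / (1/2)^Suc n) * (b (Suc n) - b n), max 0 (snd p - (1/2)^Suc n))"

definition shift :: "real \<times> real \<Rightarrow> real \<times> real" where
  "shift p = (if fst p \<in> range b then glide (inv b (fst p)) p else p)"

lemma shift_tooth: "shift (b n, y) = glide n (b n, y)"
  using inj_b by (simp add: shift_def)

lemma glide_base: "glide n (b n, 0) = (b n, 0)"
  by (simp add: glide_def)

lemma shift_base [simp]: "shift (x, 0) = (x, 0)"
  by (cases "x \<in> range b") (auto simp: shift_tooth glide_base, simp add: shift_def)

lemma shift_low:
  assumes "0 \<le> y" "y \<le> (1/2)^Suc n"
  shows "snd (shift (b n, y)) = 0"
  using assms by (simp add: shift_tooth glide_def)

lemma shift_high:
  assumes "(1/2)^Suc n \<le> y"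
  shows "shift (b n, y) = (b (Suc n), y - (1/2)^Suc n)"
proof -
  have "1 \<le> y / (1/2)^Suc n" using assms by (subst le_divide_eq) simp
  then show ?thesis using assms by (simp add: shift_tooth glide_def min_absorb1 del: power_Suc)
qed

lemma shift_mem_comb:
  assumes "p \<in> comb UNIV"
  shows "shift p \<in> comb UNIV"
proof (cases "snd p = 0")
  case True
  then show ?thesis using assms by (cases p) simp
next
  case False
  then obtain n y where p: "p = (b n, y)" "0 < y" "y \<le> (1/2)^n"
    using assms by (cases p) (auto simp: mem_comb)
  show ?thesis
  proof (cases "(1/2)^Suc n \<le> y")
    case True
    then show ?thesis using p by (auto simp: shift_high mem_comb)
  next
    case False
    let ?t = "y / (1/2)^Suc n"
    have t: "0 \<le> ?t" "?t \<le> 1" using p False by (auto simp: divide_simps)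
    have "b n + t * (b (Suc n) - b n) \<in> {-1..1}" if "0 \<le> t" "t \<le> 1" for t
    proof -
      have "(1 - t) *\<^sub>R b n + t *\<^sub>R b (Suc n) \<in> {-1..1}"
        using that by (intro convexD_alt[OF convex_real_interval(5)] b_range) auto
      then show ?thesis by (simp add: algebra_simps)
    qed
    from this[OF t] show ?thesis
      using False t by (simp add: p shift_tooth glide_def mem_comb max_def min_absorb2 del: power_Suc)
  qed
qed

text \<open>The two displacements are bounded separately. The bound does not depend on
  \<open>y\<close> and vanishes as \<open>n\<close> grows if the increments of \<open>b\<close> do,
  which makes the approximation of \<open>shift\<close> uniform.\<close>

lemma dist_shift_le:
  assumes "0 \<le> y" "y \<le> (1/2)^n"
  shows "dist (shift (b n, y)) (b n, y) \<le> \<bar>b (Suc n) - b n\<bar> + (1/2)^n"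
proof -
  let ?t = "min 1 (y / (1/2)^Suc n)"
  have "dist (shift (b n, y)) (b n, y) \<le> \<bar>?t * (b (Suc n) - b n)\<bar> + \<bar>max 0 (y - (1/2)^Suc n) - y\<bar>"
    unfolding shift_tooth glide_def dist_Pair_Pair dist_real_def
    using sqrt_sum_squares_le_sum_abs[of "?t * (b (Suc n) - b n)" "max 0 (y - (1/2)^Suc n) - y"]
    by simp
  also have "\<bar>?t * (b (Suc n) - b n)\<bar> \<le> \<bar>b (Suc n) - b n\<bar>"
    using assms unfolding abs_mult by (intro mult_left_le_one_le) auto
  also have "\<bar>max 0 (y - (1/2)^Suc n) - y\<bar> \<le> (1/2)^n"
    using assms zero_le_power[of "1/2::real" "Suc n"] by (auto simp: max_def abs_if)
  finally show ?thesis by simp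
qed

text \<open>Uniform approximation by the maps that act on the first \<open>N\<close> teeth only.\<close>
lemma continuous_on_shift:
  assumes step: "(\<lambda>n. b (Suc n) - b n) \<longlonglongrightarrow> 0"
  shows "continuous_on (comb UNIV) shift"
proof (rule uniform_limit_theorem)
  define F where "F N p = (if fst p \<in> b ` {..<N} then shift p else p)" for N p
  have F0: "F N (x, 0) = (x, 0)" for N x by (simp add: F_def)
  have "continuous_on (comb UNIV) (F N)" for N
  proof (induction N)
    case 0
    then show ?case by (simp add: F_def continuous_on_id)
  next
    case (Suc N)
    \<comment> \<open>Passing from \<open>F N\<close> to \<open>F (Suc N)\<close> alters the map on
      the \<open>N\<close>-th tooth only, where it becomes \<open>glide N\<close>; the two closed
      pieces are glued.\<close>
    show ?case
      unfolding comb_UNIV_split[of N]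
    proof (rule continuous_on_closed_Un)
      have "continuous_on (tooth N) (glide N)"
        unfolding glide_def by (intro continuous_intros) auto
      then show "continuous_on (tooth N) (F (Suc N))"
        by (rule continuous_on_eq) (auto simp: F_def tooth_def shift_tooth)
      have "continuous_on (comb (-{N})) (F N)"
        using Suc comb_UNIV_split[of N] continuous_on_subset by blast
      then show "continuous_on (comb (-{N})) (F (Suc N))"
      proof (rule continuous_on_eq)
        fix p assume "p \<in> comb (-{N})"
        then show "F N p = F (Suc N) p"
          by (cases p) (auto simp: mem_comb F_def lessThan_Suc)
      qed
    qed (auto intro: compact_imp_closed compact_tooth compact_comb)
  qed
  then show "\<forall>\<^sub>F N in sequentially. continuous_on (comb UNIV) (F N)" by simp
  show "uniform_limit (comb UNIV) F shift sequentially"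
  proof (rule uniform_limitI)
    fix e :: real assume "e > 0"
    have lim: "(\<lambda>n. \<bar>b (Suc n) - b n\<bar> + (1/2)^n) \<longlonglongrightarrow> 0"
      using tendsto_add[OF tendsto_rabs_zero[OF step] LIMSEQ_power_zero[of "1/2::real"]] by simp
    obtain N0 where N0: "\<And>n. n \<ge> N0 \<Longrightarrow> \<bar>b (Suc n) - b n\<bar> + (1/2)^n < e"
      using order_tendstoD(2)[OF lim \<open>e > 0\<close>] unfolding eventually_sequentially by blast
    have "dist (F N p) (shift p) < e" if N: "N \<ge> N0" "p \<in> comb UNIV" for N p
    proof (cases "snd p = 0 \<or> fst p \<in> b ` {..<N}")
      case True
      then show ?thesis using \<open>e > 0\<close> by (cases p) (auto simp: F0, auto simp: F_def)
    next
      case False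
      then obtain n y where p: "p = (b n, y)" "0 \<le> y" "y \<le> (1/2)^n"
        using N(2) by (cases p) (auto simp: mem_comb)
      then have "n \<ge> N" using False by (cases "n < N") auto
      then have "\<bar>b (Suc n) - b n\<bar> + (1/2)^n < e" using N(1) by (intro N0) simp
      with dist_shift_le[OF p(2,3)] have "dist (shift p) p < e" unfolding p(1) by linarith
      then show ?thesis using False by (simp add: F_def dist_commute)
    qed
    then show "\<forall>\<^sub>F N in sequentially. \<forall>p\<in>comb UNIV. dist (F N p) (shift p) < e"
      unfolding eventually_sequentially by blast
  qed
qed simp

lemma funpow_shift_base [simp]: "(shift ^^ k) (x, 0) = (x, 0)"
  by (induction k) auto

lemma funpow_shift_tip: "(shift ^^ k) (b n, (1/2)^n) = (b (n + k), (1/2)^(n + k))"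
proof (induction k)
  case (Suc k)
  have "shift (b (n + k), (1/2)^(n + k)) = (b (Suc (n + k)), (1/2)^Suc (n + k))"
    by (subst shift_high) auto
  then show ?case by (simp add: Suc)
qed simp

text \<open>The distance from a point to the tip of its tooth is invariant until the point reaches the base.\<close>
lemma funpow_shift_below_tip:
  assumes "0 \<le> y" "y + (1/2)^(n + k) \<le> (1/2)^n"
  shows "snd ((shift ^^ k) (b n, y)) = 0"
  using assms
\<comment> \<open>One application of \<open>shift\<close> either reaches the base or leads to tooth
  \<open>Suc n\<close> at the same distance from its tip. For \<open>k = 0\<close> the assumptions
  force \<open>y = 0\<close>.\<close>
proof (induction k arbitrary: n y)
  case (Suc k)
  show ?case
  proof (cases "y \<le> (1/2)^Suc n")
    case True
    then have "shift (b n, y) = (fst (shift (b n, y)), 0)"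
      using shift_low[of y n] Suc.prems by (simp add: prod_eq_iff)
    then show ?thesis by (metis funpow_Suc_right funpow_shift_base o_apply snd_conv)
  next
    case False
    then have "snd ((shift ^^ k) (b (Suc n), y - (1/2)^Suc n)) = 0"
      using Suc.prems by (intro Suc.IH) auto
    then show ?thesis using False by (simp only: funpow_Suc_right o_apply shift_high)
  qed
qed simp

text \<open>A point off the base and below a tip keeps its distance to the current tip until it
  reaches the base. The heights of the teeth shrink below this distance, so it does reach the base,
  where it stays.\<close>

lemma eventually_fixed:
  assumes "p \<in> comb UNIV" "p \<notin> range (\<lambda>n. (b n, (1/2)^n))"
  shows "\<exists>c. \<forall>\<^sub>F k in sequentially. (shift ^^ k) p = c"
proof -
  have "\<exists>j. snd ((shift ^^ j) p) = 0"
  proof (cases "snd p = 0")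
    case True
    then show ?thesis by (intro exI[of _ 0]) simp
  next
    case False
    then obtain n y where p: "p = (b n, y)" "0 \<le> y" "y \<le> (1/2)^n"
      using assms(1) by (cases p) (auto simp: mem_comb)
    then have "y < (1/2)^n" using assms(2) by (cases "y = (1/2)^n") auto
    then obtain j where j: "(1/2)^j < (1/2)^n - y"
      using real_arch_pow_inv[of "(1/2)^n - y" "1/2"] by auto
    have "(1/2)^(n + j) \<le> (1/2::real)^j" by (intro power_decreasing) auto
    then have "y + (1/2)^(n + j) \<le> (1/2)^n" using j by linarith
    then have "snd ((shift ^^ j) (b n, y)) = 0" using p by (intro funpow_shift_below_tip)
    then show ?thesis using p by blast
  qed
  then obtain j x where j: "(shift ^^ j) p = (x, 0)" by (metis prod.collapse)
  have "(shift ^^ k) p = (x, 0)" if "k \<ge> j" for k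
  proof -
    have "(shift ^^ k) p = (shift ^^ (k - j)) ((shift ^^ j) p)"
      using that by (metis funpow_add le_add_diff_inverse2 o_apply)
    then show ?thesis using j by simp
  qed
  then show ?thesis by (auto simp: eventually_sequentially)
qed

text \<open>At time \<open>k\<close> the two points are the tips of teeth \<open>m + k\<close> and
  \<open>n + k\<close>. Their abscissae differ by boundedly many increments of \<open>b\<close>, and
  both heights tend to 0.\<close>

lemma tips_asymptotic:
  assumes step: "(\<lambda>n. b (Suc n) - b n) \<longlonglongrightarrow> 0"
  shows "(\<lambda>k. dist ((shift ^^ k) (b m, (1/2)^m)) ((shift ^^ k) (b n, (1/2)^n))) \<longlonglongrightarrow> 0"
proof -
  have diff: "(\<lambda>k. b (k + j) - b k) \<longlonglongrightarrow> 0" for j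
  proof (induction j)
    case (Suc j)
    have "(\<lambda>k. (b (Suc (k + j)) - b (k + j)) + (b (k + j) - b k)) \<longlonglongrightarrow> 0 + 0"
      by (intro tendsto_add Suc LIMSEQ_ignore_initial_segment[OF step])
    then show ?case by simp
  qed simp
  have "(\<lambda>k. (b (k + m) - b k) - (b (k + n) - b k)) \<longlonglongrightarrow> 0 - 0"
    by (intro tendsto_diff diff)
  then have 1: "(\<lambda>k. \<bar>b (m + k) - b (n + k)\<bar>) \<longlonglongrightarrow> 0"
    by (intro tendsto_rabs_zero) (simp add: add.commute)
  have pow: "(\<lambda>k. (1/2::real)^(j + k)) \<longlonglongrightarrow> 0" for j
    using LIMSEQ_ignore_initial_segment[OF LIMSEQ_power_zero[of "1/2::real"], of j]
    by (simp add: add.commute)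
  have "(\<lambda>k. (1/2::real)^(m + k) - (1/2)^(n + k)) \<longlonglongrightarrow> 0 - 0"
    by (intro tendsto_diff pow)
  then have "(\<lambda>k. \<bar>(1/2::real)^(m + k) - (1/2)^(n + k)\<bar>) \<longlonglongrightarrow> 0"
    by (intro tendsto_rabs_zero) simp
  with 1 have lim: "(\<lambda>k. \<bar>b (m + k) - b (n + k)\<bar> + \<bar>(1/2::real)^(m + k) - (1/2)^(n + k)\<bar>) \<longlonglongrightarrow> 0 + 0"
    by (rule tendsto_add)
  show ?thesis
    unfolding funpow_shift_tip dist_Pair_Pair dist_real_def
    using lim by (intro Lim_null_comparison[OF always_eventually lim[simplified]])
      (auto intro: sqrt_sum_squares_le_sum_abs[of "b _ - b _", simplified])
qed

end

section \<open>Scrambled sets and assembly of the example\<close>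

text \<open>Convergence would make the liminf 0 and the positive limsup equal.\<close>

lemma LY_scrambled_not_convergent:
  assumes "LY_scrambled m f S" "x \<in> S" "y \<in> S" "x \<noteq> y"
  shows "\<not> (\<lambda>n. mdist m ((f ^^ n) x) ((f ^^ n) y)) \<longlonglongrightarrow> L"
proof
  let ?d = "\<lambda>n. ereal (mdist m ((f ^^ n) x) ((f ^^ n) y))"
  assume "(\<lambda>n. mdist m ((f ^^ n) x) ((f ^^ n) y)) \<longlonglongrightarrow> L"
  then have "?d \<longlonglongrightarrow> ereal L" by simp
  then have "liminf ?d = ereal L" "limsup ?d = ereal L"
    by (simp_all add: lim_imp_Liminf lim_imp_Limsup)
  moreover have "liminf ?d = 0" "0 < limsup ?d"
    using assms unfolding LY_scrambled_def by blast+
  ultimately show False by simp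
qed

lemma finite_if_all_eq: "(\<And>x y. x \<in> A \<Longrightarrow> y \<in> A \<Longrightarrow> x = y) \<Longrightarrow> finite A"
  by (metis finite.simps subsetI finite_subset insertI1)

theorem theorem7p6:
  shows "\<exists>(D :: (nat \<Rightarrow> real) metric) (f :: (nat \<Rightarrow> real) \<Rightarrow> (nat \<Rightarrow> real)).
           dendrite D \<and> continuous_map (mtopology_of D) (mtopology_of D) f \<and>
           (\<exists>x y. DC1_pair D f x y) \<and>
           \<not> (\<exists>S. infinite S \<and> LY_scrambled D f S)"
proof -
  obtain b where b: "inj b" "\<And>n. b n \<in> {-1..1}" and b_osc: "(\<lambda>n. b n - osc n) \<longlonglongrightarrow> 0"
    using injective_osc by blast
  interpret comb_teeth b by unfold_locales (use b in auto)
  let ?K = "comb UNIV"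
  have "(\<lambda>n. (b (Suc n) - osc (Suc n)) - (b n - osc n) + (osc (Suc n) - osc n)) \<longlonglongrightarrow> 0 - 0 + 0"
    by (intro tendsto_add tendsto_diff b_osc LIMSEQ_Suc[OF b_osc] osc_increment)
  then have step: "(\<lambda>n. b (Suc n) - b n) \<longlonglongrightarrow> 0" by simp

  \<comment> \<open>The abscissa sits at index 0 and the height at every other index.\<close>
  define e :: "real \<times> real \<Rightarrow> nat \<Rightarrow> real" where "e p n = (if n = 0 then fst p else snd p)" for p n
  have "inj e"
  proof (rule injI)
    fix p q assume "e p = e q"
    then have "e p 0 = e q 0" "e p 1 = e q 1" by simp_all
    then show "p = q" by (simp add: e_def prod_eq_iff)
  qed
  then obtain m where m: "mspace m = e ` ?K" "\<And>x y. mdist m (e x) (e y) = dist x y"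
      and hom: "homeomorphic_maps (top_of_set ?K) (mtopology_of m) e (inv e)"
    using isometric_copy[of e ?K] by blast
  have inv_e [simp]: "inv e (e p) = p" for p using \<open>inj e\<close> by simp
  define f where "f = e \<circ> shift \<circ> inv e"
  have f_pow: "(f ^^ k) (e p) = e ((shift ^^ k) p)" for k p
    by (induction k) (auto simp: f_def)

  have homeo: "mtopology_of m homeomorphic_space top_of_set ?K"
    using hom homeomorphic_space_def homeomorphic_space_sym by blast
  have cont_e: "continuous_map (top_of_set ?K) (mtopology_of m) e"
    and cont_inv: "continuous_map (mtopology_of m) (top_of_set ?K) (inv e)"
    using hom by (auto simp: homeomorphic_maps_def)
  have "\<not> subtopology (mtopology_of m) C homeomorphic_space top_of_set (sphere (0::complex) 1)" for C
  proof (rule no_circle_if_separated)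
    fix p' q' assume "p' \<in> topspace (mtopology_of m)" "q' \<in> topspace (mtopology_of m)" "p' \<noteq> q'"
    then obtain p q where pq: "p \<in> ?K" "q \<in> ?K" "p \<noteq> q" "p' = e p" "q' = e q"
      using m(1) by auto
    then obtain z where z: "z \<noteq> p" "z \<noteq> q"
        "\<And>S. connected S \<Longrightarrow> S \<subseteq> ?K \<Longrightarrow> p \<in> S \<Longrightarrow> q \<in> S \<Longrightarrow> z \<in> S"
      using comb_separated[of p q] by blast
    \<comment> \<open>Connected sets of the copy are pulled back along \<open>inv e\<close>, where
      the separation of the comb applies.\<close>
    have "e z \<in> S" if S: "connectedin (mtopology_of m) S" "p' \<in> S" "q' \<in> S" for S
    proof -
      have "connectedin (top_of_set ?K) (inv e ` S)"
        using connectedin_continuous_map_image[OF cont_inv S(1)] .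
      then have "connected (inv e ` S)" "inv e ` S \<subseteq> ?K"
        by (auto simp: connectedin_subtopology)
      moreover have "p \<in> inv e ` S" "q \<in> inv e ` S"
        using S(2,3) pq(4,5) by (metis imageI inv_e)+
      ultimately have "z \<in> inv e ` S" by (rule z(3))
      then obtain s where "s \<in> S" "z = inv e s" by blast
      moreover have "s \<in> e ` ?K"
        using connectedin_subset_topspace[OF S(1)] \<open>s \<in> S\<close> m(1) by auto
      ultimately show ?thesis by auto
    qed
    moreover have "e z \<noteq> p'" "e z \<noteq> q'" using z(1,2) pq(4,5) \<open>inj e\<close> by (auto simp: inj_eq)
    ultimately show "\<exists>z. z \<noteq> p' \<and> z \<noteq> q' \<and>
        (\<forall>S. connectedin (mtopology_of m) S \<and> p' \<in> S \<and> q' \<in> S \<longrightarrow> z \<in> S)" by blast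
  qed
  moreover have "?K \<noteq> {}" by (auto simp: comb_def)
  ultimately have "dendrite m"
    using homeomorphic_compact_space[OF homeo] homeomorphic_connected_space[OF homeo]
      homeomorphic_locally_connected_space[OF homeo]
      compact_comb connected_comb locally_connected_comb m(1)
    by (simp add: dendrite_def continuum_def compact_space_subtopology connected_space_subtopology)

  moreover have "continuous_map (mtopology_of m) (mtopology_of m) f"
  proof -
    have "continuous_map (top_of_set ?K) (top_of_set ?K) shift"
      using continuous_on_shift[OF step] shift_mem_comb by (auto simp: continuous_map_in_subtopology)
    from continuous_map_compose[OF cont_inv continuous_map_compose[OF this cont_e]]
    show ?thesis by (simp add: f_def)
  qed

  moreover have "DC1_pair m f (e (b 0, 1)) (e (-1, 0))"
  proof -
    \<comment> \<open>The point \<open>(b 0, 1)\<close> is the tip of tooth 0 and is at the tip of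
      tooth \<open>i\<close> at time \<open>i\<close>, while \<open>(-1, 0)\<close> is fixed;
      \<open>d i\<close> is their distance at that time.\<close>
    define d where "d i = dist (b i, (1/2)^i) (-1 :: real, 0 :: real)" for i
    have freq: "dist_freq m f (e (b 0, 1)) (e (-1, 0)) n t = real (card {i. i < n \<and> d i < t}) / real n" for n t
      using funpow_shift_tip[of _ 0] by (simp add: dist_freq_def f_pow m(2) d_def)
    have d_osc: "(\<lambda>i. d i - (1 + osc i)) \<longlonglongrightarrow> 0"
    proof (rule Lim_null_comparison)
      have "\<bar>d i - (1 + osc i)\<bar> \<le> \<bar>b i - osc i\<bar> + (1/2)^i" for i
      proof -
        have "d i \<le> \<bar>b i + 1\<bar> + \<bar>(1/2)^i\<bar>"
          using sqrt_sum_squares_le_sum_abs[of "b i + 1" "(1/2)^i"]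
          by (simp add: d_def dist_Pair_Pair dist_real_def)
        moreover have "\<bar>b i + 1\<bar> \<le> d i"
          using dist_fst_le[of "(b i, (1/2)^i)" "(-1, 0::real)"] by (simp add: d_def dist_real_def)
        moreover have "0 \<le> b i + 1" using b_bounds[of i] by linarith
        ultimately show ?thesis by simp
      qed
      then show "\<forall>\<^sub>F i in sequentially. norm (d i - (1 + osc i)) \<le> \<bar>b i - osc i\<bar> + (1/2)^i"
        by simp
      have "(\<lambda>i. \<bar>b i - osc i\<bar> + (1/2)^i) \<longlonglongrightarrow> 0 + 0"
        by (intro tendsto_add tendsto_rabs_zero b_osc LIMSEQ_power_zero) simp
      then show "(\<lambda>i. \<bar>b i - osc i\<bar> + (1/2)^i) \<longlonglongrightarrow> 0" by simp
    qed
    have windows: "\<exists>M N. filterlim N sequentially sequentially \<and> (\<lambda>k. real (M k) / real (N k)) \<longlonglongrightarrow> 0 \<and>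
        (\<forall>\<^sub>F k in sequentially. \<forall>i. M k \<le> i \<and> i < N k \<longrightarrow> \<bar>d i - (1 + sin \<theta>)\<bar> < r)"
      if "r > 0" for r \<theta> :: real
    proof -
      \<comment> \<open>One half of \<open>r\<close> pays for the oscillation in the window, the
        other for replacing \<open>d i\<close> by \<open>1 + osc i\<close>.\<close>
      have "r / 2 > 0" using that by simp
      then obtain M N where M: "filterlim M sequentially sequentially"
          and N: "filterlim N sequentially sequentially" "(\<lambda>k. real (M k) / real (N k)) \<longlonglongrightarrow> 0"
          and near: "\<And>k i. M k \<le> i \<Longrightarrow> i < N k \<Longrightarrow> \<bar>osc i - sin \<theta>\<bar> \<le> r / 2"
        using osc_windows[of "r / 2" \<theta>] by blast
      obtain i0 where i0: "\<And>i. i \<ge> i0 \<Longrightarrow> \<bar>d i - (1 + osc i)\<bar> < r / 2"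
        using LIMSEQ_D[OF d_osc \<open>r / 2 > 0\<close>] unfolding diff_0_right real_norm_def by blast
      have "\<forall>\<^sub>F k in sequentially. i0 \<le> M k" using M by (simp add: filterlim_at_top)
      then have "\<forall>\<^sub>F k in sequentially. \<forall>i. M k \<le> i \<and> i < N k \<longrightarrow> \<bar>d i - (1 + sin \<theta>)\<bar> < r"
      proof eventually_elim
        case (elim k)
        have "\<bar>d i - (1 + sin \<theta>)\<bar> < r" if "M k \<le> i" "i < N k" for i
          using near[OF that] i0[of i] elim that by linarith
        then show ?case by blast
      qed
      with N show ?thesis by blast
    qed
    have "upper_distribution m f (e (b 0, 1)) (e (-1, 0)) t = 1" if "t > 0" for t
    proof -
      \<comment> \<open>At \<open>-pi/2\<close> the value \<open>1 + sin \<theta>\<close> is 0: the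
        tips linger at the left end.\<close>
      obtain M N where MN: "filterlim N sequentially sequentially" "(\<lambda>k. real (M k) / real (N k)) \<longlonglongrightarrow> 0"
          "\<forall>\<^sub>F k in sequentially. \<forall>i. M k \<le> i \<and> i < N k \<longrightarrow> \<bar>d i - (1 + sin (- (pi / 2)))\<bar> < t"
        using windows[OF \<open>t > 0\<close>] by blast
      have "\<forall>\<^sub>F k in sequentially. \<forall>i. M k \<le> i \<and> i < N k \<longrightarrow> d i < t"
        using MN(3) by (rule eventually_mono) (auto simp: abs_less_iff)
      from limsup_frequency_windows[OF MN(1,2) this] show ?thesis
        using that by (simp add: upper_distribution_def freq)
    qed
    moreover have "lower_distribution m f (e (b 0, 1)) (e (-1, 0)) 1 = 0"
    proof -
      \<comment> \<open>The threshold 1 must not exceed the diameter, beyond which the distribution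
        is set to 1 by definition.\<close>
      have K: "(-1, 0) \<in> ?K" "(1, 0) \<in> ?K" by (simp_all add: mem_comb)
      have "bounded ?K" using compact_comb by (rule compact_imp_bounded)
      then obtain B where "\<And>x y. x \<in> ?K \<Longrightarrow> y \<in> ?K \<Longrightarrow> dist x y \<le> B"
        using bounded_two_points by metis
      then have "bdd_above ((\<lambda>p. mdist m (fst p) (snd p)) ` (mspace m \<times> mspace m))"
        by (intro bdd_aboveI[of _ B]) (auto simp: m)
      then have "mdist m (fst (e (-1, 0), e (1, 0))) (snd (e (-1, 0), e (1, 0))) \<le> mdiam m"
        unfolding mdiam_def using K m(1) by (intro cSUP_upper) auto
      then have diam: "1 \<le> mdiam m" by (simp add: m(2) dist_Pair_Pair dist_real_def)
      \<comment> \<open>At \<open>pi/2\<close> the value \<open>1 + sin \<theta>\<close> is 2, so in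
        these windows the distance stays above 1.\<close>
      obtain M N where MN: "filterlim N sequentially sequentially" "(\<lambda>k. real (M k) / real (N k)) \<longlonglongrightarrow> 0"
          "\<forall>\<^sub>F k in sequentially. \<forall>i. M k \<le> i \<and> i < N k \<longrightarrow> \<bar>d i - (1 + sin (pi / 2))\<bar> < 1"
        using windows[OF zero_less_one] by blast
      have "\<forall>\<^sub>F k in sequentially. \<forall>i. M k \<le> i \<and> i < N k \<longrightarrow> 1 \<le> d i"
        using MN(3) by (rule eventually_mono) (fastforce simp: abs_less_iff)
      from liminf_frequency_windows[OF MN(1,2) this] show ?thesis
        using diam by (simp add: lower_distribution_def freq not_le)
    qed
    moreover have "(b 0, 1) \<in> ?K" "(-1, 0) \<in> ?K" by (auto simp: mem_comb intro: exI[of _ 0])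
    ultimately show ?thesis
      unfolding DC1_pair_def m(1) by (intro conjI allI impI exI[of _ 1] imageI) auto
  qed

  moreover have "finite S" if S: "LY_scrambled m f S" for S
  proof -
    \<comment> \<open>\<open>S\<close> is split into tips and other points. Within each class the
      distance of two orbits converges, so each contains at most one point of
      \<open>S\<close>.\<close>
    let ?T = "e ` range (\<lambda>n. (b n, (1/2)^n))"
    have same: "e p = e q"
      if "e p \<in> S" "e q \<in> S" "(\<lambda>k. dist ((shift ^^ k) p) ((shift ^^ k) q)) \<longlonglongrightarrow> L" for p q L
      using LY_scrambled_not_convergent[OF S that(1,2), of L] that(3) by (auto simp: f_pow m(2))
    have "S \<subseteq> e ` ?K" using S m(1) by (simp add: LY_scrambled_def)
    have "finite (S \<inter> ?T)"
      using tips_asymptotic[OF step] by (intro finite_if_all_eq) (auto intro!: same)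
    moreover have "finite (S - ?T)"
    proof (rule finite_if_all_eq)
      fix p' q' assume *: "p' \<in> S - ?T" "q' \<in> S - ?T"
      with \<open>S \<subseteq> e ` ?K\<close> obtain p q where pq: "p' = e p" "p \<in> ?K" "q' = e q" "q \<in> ?K" by blast
      have "p \<notin> range (\<lambda>n. (b n, (1/2)^n))" "q \<notin> range (\<lambda>n. (b n, (1/2)^n))"
        using * unfolding pq by blast+
      then obtain c c' where "\<forall>\<^sub>F k in sequentially. (shift ^^ k) p = c"
          "\<forall>\<^sub>F k in sequentially. (shift ^^ k) q = c'"
        using eventually_fixed pq by blast
      then have "\<forall>\<^sub>F k in sequentially. dist ((shift ^^ k) p) ((shift ^^ k) q) = dist c c'"
        by eventually_elim simp
      then have "(\<lambda>k. dist ((shift ^^ k) p) ((shift ^^ k) q)) \<longlonglongrightarrow> dist c c'"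
        by (rule tendsto_eventually)
      then show "p' = q'" using same * pq by blast
    qed
    ultimately have "finite ((S \<inter> ?T) \<union> (S - ?T))" by (rule finite_UnI)
    then show ?thesis by (simp add: Int_Diff_Un)
  qed
  ultimately show ?thesis by blast
qed

end
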